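(* Let $m\ge3$, and let $v,t$ be $2m$-closed initial data for circle intersection dynamics such that $v_i=0$ for all $i\in2\mathbb Z$. Assume that the propagation map $T$ can be applied at least $2m-4$ times. Then there is $s\in\hat{\mathbb C}$ such that $\tilde w_{i,2m-3}=s$ for all $i\in2\mathbb Z+1$. That is, the singularity repeats after $2m-4$ steps (the row $\tilde w_{2m-3}$ being a row of circle intersection points).
   Context: $\hat{\mathbb C}=\mathbb C\cup\{\infty\}$. Initial data for circle intersection dynamics consist of points $(v_i)_{i\in\mathbb Z}$ in $\mathbb C$ and centers $(t_i)_{i\in\mathbb Z}$ such that $v_{i-1},v_i,v_{i+1}$ lie on a circle $c_i$ with center $t_i$ (generically the points determine the centers, but for singular data they are prescribed separately). They are $2m$-closed if $v_{i+2m}=v_i$ and $t_{i+2m}=t_i$ for all $i$. Set, for even $i$, $\tilde z_{i,0}=v_i$, $\tilde w_{i,0}=t_i$, and for odd $i$, $\tilde w_{i,1}=v_i$, $\tilde z_{i,1}=t_i$. The propagation map $T:(\tilde z_j,\tilde w_j,\tilde z_{j+1},\tilde w_{j+1})\mapsto(\tilde z_{j+1},\tilde w_{j+1},\tilde z_{j+2},\tilde w_{j+2})$, where $\tilde z_j=(\tilde z_{i,j})_{i\equiv j \bmod 2}$ and similarly for $\tilde w_j$, is defined as follows. If $j$ is even (and $i$ even): $\tilde z_{i,j+2}$ is the intersection point other than $\tilde z_{i,j}$ of the circles centered at $\tilde z_{i-1,j+1}$ and $\tilde z_{i+1,j+1}$ passing through $\tilde z_{i,j}$, and $\tilde w_{i,j+2}$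 is the center of the circle through $\tilde w_{i-1,j+1},\tilde w_{i+1,j+1},\tilde z_{i,j+2}$. If $j$ is odd (and $i$ odd): the same with the roles of $\tilde z$ and $\tilde w$ exchanged. "$T$ can be applied" means that these steps are well defined; standing assumption: the data are as generic as possible given the initial singularity. *)

theory Defs
  imports "HOL-Analysis.Analysis"
begin

text \<open>The Riemann sphere, in the encoding the library uses for one-point compactifications:
  \<open>None\<close> is the point at infinity.\<close>

type_synonym riemann_sphere = "complex option"

definition circle_with_center :: "complex \<Rightarrow> complex set \<Rightarrow> bool" where
  "circle_with_center c C \<longleftrightarrow> (\<exists>r>0. C = sphere c r)"

definition circle_initial_data :: "(int \<Rightarrow> complex) \<Rightarrow> (int \<Rightarrow> complex) \<Rightarrow> bool" where
  "circle_initial_data v t \<longleftrightarrow>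
     (\<forall>i. \<exists>C. circle_with_center (t i) C \<and> {v (i - 1), v i, v (i + 1)} \<subseteq> C)"

definition closed_data :: "nat \<Rightarrow> (int \<Rightarrow> complex) \<Rightarrow> (int \<Rightarrow> complex) \<Rightarrow> bool" where
  "closed_data n v t \<longleftrightarrow> (\<forall>i. v (i + int n) = v i \<and> t (i + int n) = t i)"

text \<open>The arrays \<open>z\<close> and \<open>w\<close> are read only at positions \<open>(i, j)\<close> with \<open>i\<close> and \<open>j\<close> of the
  same parity; their other entries are irrelevant.\<close>

definition initial_rows ::
  "(int \<Rightarrow> complex) \<Rightarrow> (int \<Rightarrow> complex) \<Rightarrow>
   (int \<Rightarrow> nat \<Rightarrow> complex) \<Rightarrow> (int \<Rightarrow> nat \<Rightarrow> complex) \<Rightarrow> bool" where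
  "initial_rows v t z w \<longleftrightarrow>
     (\<forall>i. even i \<longrightarrow> z i 0 = v i \<and> w i 0 = t i) \<and>
     (\<forall>i. odd i \<longrightarrow> w i 1 = v i \<and> z i 1 = t i)"

text \<open>\<open>q\<close> is the intersection point other than \<open>p\<close> of the circles centered at \<open>a\<close> and \<open>b\<close> that
  pass through \<open>p\<close>. For coinciding or tangent circles there is no such \<open>q\<close>.\<close>

definition other_intersection :: "complex \<Rightarrow> complex \<Rightarrow> complex \<Rightarrow> complex \<Rightarrow> bool" where
  "other_intersection a b p q \<longleftrightarrow>
     q \<noteq> p \<and> sphere a (dist a p) \<inter> sphere b (dist b p) = {p, q}"

text \<open>\<open>c\<close> is the center of the circle through \<open>x\<close>, \<open>y\<close> and \<open>u\<close>; this includes that the circle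
  exists and is unique, so there is no such \<open>c\<close> if the points are collinear or not distinct.\<close>

definition center_of_circle_through :: "complex \<Rightarrow> complex \<Rightarrow> complex \<Rightarrow> complex \<Rightarrow> bool" where
  "center_of_circle_through x y u c \<longleftrightarrow>
     (\<exists>C. circle_with_center c C \<and> {x, y, u} \<subseteq> C) \<and>
     (\<forall>c' C'. circle_with_center c' C' \<and> {x, y, u} \<subseteq> C' \<longrightarrow> c' = c)"

text \<open>Row \<open>j + 2\<close> is produced from rows \<open>j\<close> and \<open>j + 1\<close>, where \<open>x\<close> holds the intersection points
  and \<open>y\<close> the circle centers of row \<open>j + 2\<close>.\<close>

definition propagation_row ::
  "(int \<Rightarrow> nat \<Rightarrow> complex) \<Rightarrow> (int \<Rightarrow> nat \<Rightarrow> complex) \<Rightarrow> nat \<Rightarrow> bool" where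
  "propagation_row x y j \<longleftrightarrow>
     (\<forall>i. even i = even j \<longrightarrow>
        other_intersection (x (i - 1) (j + 1)) (x (i + 1) (j + 1)) (x i j) (x i (j + 2)) \<and>
        center_of_circle_through (y (i - 1) (j + 1)) (y (i + 1) (j + 1)) (x i (j + 2))
          (y i (j + 2)))"

text \<open>The graph of the propagation map at \<open>j\<close>: the map is defined on rows \<open>j\<close> and \<open>j + 1\<close> of \<open>z\<close>
  and \<open>w\<close>, and its value consists of rows \<open>j + 1\<close> and \<open>j + 2\<close>. Those rows are uniquely determined
  at the positions of matching parity, since both relations above are functional in their last
  argument.\<close>

definition propagation ::
  "(int \<Rightarrow> nat \<Rightarrow> complex) \<Rightarrow> (int \<Rightarrow> nat \<Rightarrow> complex) \<Rightarrow> nat \<Rightarrow> bool" where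
  "propagation z w j \<longleftrightarrow> (if even j then propagation_row z w j else propagation_row w z j)"

end

theory Submission
  imports Defs
begin

text \<open>
  Four circles through the triples of four points give, with their centers, two instances of the
  discrete Schwarzian KP equation (multi-ratio \<open>-1\<close> on an octahedron). By Menelaus' theorem this
  equation is the compatibility condition of a linear problem with a spectral parameter \<open>\<lambda>\<close>: affine
  functions \<open>U\<^sub>i(\<lambda>)\<close> and \<open>V\<^sub>i(\<lambda>)\<close> with \<open>U\<^sub>i = V\<^sub>i\<close> at the intersection point and
  \<open>U\<^sub>i = \<lambda> V\<^sub>i\<close> at the circle center (or conversely) in the next row, such that the functions at
  \<open>i - 1\<close> and \<open>i + 1\<close> agree at the points of the current row. For a solution that is polynomial in
  \<open>\<lambda>\<close>, these conditions lower the degree by one in every two propagation steps. If all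
  \<open>v\<^sub>i\<close> with even \<open>i\<close> vanish, there is a nonzero solution of degree \<open>m - 2\<close> in row \<open>0\<close>. In row
  \<open>2m - 4\<close> it is constant in \<open>\<lambda>\<close>, which forces it to be one affine function independent of \<open>i\<close>;
  this function vanishes at every point \<open>w\<^sub>i\<close> of row \<open>2m - 3\<close>.
\<close>

section \<open>Affine functions of one complex variable and their interpolation\<close>

definition affine_fun :: "(complex \<Rightarrow> complex) \<Rightarrow> bool" where
  "affine_fun f \<longleftrightarrow> (\<exists>c d. \<forall>z. f z = c + d * z)"

definition interpolate :: "complex \<Rightarrow> complex \<Rightarrow> complex \<Rightarrow> complex \<Rightarrow> complex \<Rightarrow> complex" where
  "interpolate a u b v z = u * (z - b) / (a - b) + v * (z - a) / (b - a)"

lemma affine_fun_zero [simp]: "affine_fun (\<lambda>_. 0)"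
  unfolding affine_fun_def by (intro exI[of _ 0]) simp

lemma affine_fun_diff:
  assumes "affine_fun f" "affine_fun g"
  shows "affine_fun (\<lambda>z. f z - g z)"
proof -
  obtain c d c' d' where "\<And>z. f z = c + d * z" "\<And>z. g z = c' + d' * z"
    using assms unfolding affine_fun_def by metis
  then show ?thesis
    unfolding affine_fun_def
    by (intro exI[of _ "c - c'"] exI[of _ "d - d'"]) (simp add: algebra_simps)
qed

lemma affine_fun_interpolate [simp]: "affine_fun (interpolate a u b v)"
  unfolding affine_fun_def interpolate_def
  by (intro exI[of _ "- u * b / (a - b) - v * a / (b - a)"] exI[of _ "u / (a - b) + v / (b - a)"])
    (simp add: algebra_simps diff_divide_distrib)

lemma interpolate_left: "a \<noteq> b \<Longrightarrow> interpolate a u b v a = u"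
  by (simp add: interpolate_def)

lemma interpolate_right: "a \<noteq> b \<Longrightarrow> interpolate a u b v b = v"
  by (simp add: interpolate_def)

lemma interpolate_zero [simp]: "interpolate a 0 b 0 = (\<lambda>_. 0)"
  by (simp add: interpolate_def fun_eq_iff)

lemma affine_fun_Lagrange:
  assumes "affine_fun f"
  shows "f z * (a - b) = f a * (z - b) - f b * (z - a)"
proof -
  obtain c d where "\<And>z. f z = c + d * z"
    using assms unfolding affine_fun_def by metis
  then show ?thesis by (simp add: algebra_simps)
qed

lemma affine_fun_eqI:
  assumes "affine_fun f" "affine_fun g" "a \<noteq> b" "f a = g a" "f b = g b"
  shows "f = g"
proof
  fix z
  have "f z * (a - b) = g z * (a - b)"
    using affine_fun_Lagrange[OF assms(1), of z a b] affine_fun_Lagrange[OF assms(2), of z a b]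
      assms(4,5) by simp
  then show "f z = g z" using assms(3) by simp
qed

section \<open>Multi-ratio identities for circles, and Menelaus' theorem for affine
  functions\<close>

lemma equidistant_cnj:
  fixes a p x :: complex
  assumes "dist a p = dist a x"
  shows "(x - a) * cnj (x - p) = (x - p) * cnj (a - p)"
proof -
  have "(a - p) * cnj (a - p) = (a - x) * cnj (a - x)"
    using assms unfolding dist_norm by (simp only: complex_norm_square[symmetric])
  then show ?thesis by (simp add: algebra_simps)
qed

text \<open>Three circles through \<open>q\<close> meet again pairwise in \<open>p\<close>,
  \<open>x\<close>, \<open>y\<close>. Equidistance splits each factor such as \<open>x - a\<close>
  into \<open>cnj (a - q)\<close> and a factor depending on \<open>x\<close> and \<open>q\<close>
  alone; both sides then contain every center and every point once.\<close>

lemma circumcenters_hexagon: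
  fixes a b d p q x y :: complex
  assumes "dist a q = dist a p" "dist a q = dist a x" "dist b q = dist b p" "dist b q = dist b y"
    "dist d q = dist d x" "dist d q = dist d y" and ne: "p \<noteq> q" "x \<noteq> q" "y \<noteq> q"
  shows "(p - a) * (y - b) * (x - d) = (x - a) * (p - b) * (y - d)"
proof -
  note e = assms(1-6)[THEN equidistant_cnj]
  have "((p - a) * (y - b) * (x - d)) * (cnj (p - q) * cnj (y - q) * cnj (x - q))
      = ((p - a) * cnj (p - q)) * ((y - b) * cnj (y - q)) * ((x - d) * cnj (x - q))"
    by (simp only: ac_simps)
  also have "\<dots> = ((p - q) * cnj (a - q)) * ((y - q) * cnj (b - q)) * ((x - q) * cnj (d - q))"
    by (simp only: e)
  also have "\<dots> = ((x - q) * cnj (a - q)) * ((p - q) * cnj (b - q)) * ((y - q) * cnj (d - q))"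
    by (simp only: ac_simps)
  also have "\<dots> = ((x - a) * cnj (x - q)) * ((p - b) * cnj (p - q)) * ((y - d) * cnj (y - q))"
    by (simp only: e)
  also have "\<dots> = ((x - a) * (p - b) * (y - d)) * (cnj (p - q) * cnj (y - q) * cnj (x - q))"
    by (simp only: ac_simps)
  finally show ?thesis
    using ne by simp
qed

text \<open>The graphs of \<open>f\<close>, \<open>f'\<close>, \<open>g\<close>, \<open>h\<close>
  form a complete quadrilateral with vertices over \<open>p\<close>, \<open>a\<close>,
  \<open>b\<close>, \<open>x\<close>, \<open>y\<close>, \<open>d\<close>, and \<open>hex\<close> is
  the Menelaus condition for the last vertex. After subtraction of \<open>f'\<close> everything is
  computed from a multiple of \<open>z - p\<close>, also when lines coincide.\<close>

lemma menelaus_affine: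
  assumes aff: "affine_fun f" "affine_fun f'" "affine_fun g" "affine_fun h"
    and ne: "a \<noteq> b" "x \<noteq> y"
    and p: "f p = f' p"
    and g: "g a = f a" "g b = f' b" and h: "h x = f x" "h y = f' y"
    and hex: "(p - a) * (y - b) * (x - d) = (x - a) * (p - b) * (y - d)"
  shows "g d = h d"
proof -
  define D where "D = (\<lambda>z. f z - f' z)"
  define E where "E = (\<lambda>z. g z - f' z)"
  define N where "N = (\<lambda>z. h z - f' z)"
  have aD: "affine_fun D" and aE: "affine_fun E" and aN: "affine_fun N"
    unfolding D_def E_def N_def using aff by (auto intro: affine_fun_diff)
  have D0: "D p = 0" and E0: "E b = 0" "E a = D a" and N0: "N y = 0" "N x = D x"
    unfolding D_def E_def N_def using p g h by auto
  obtain c s where cs: "\<And>z. D z = c + s * z"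
    using aD unfolding affine_fun_def by metis
  have Ds: "D z = s * (z - p)" for z
    using D0 cs[of z] cs[of p] by (simp add: algebra_simps)
  have E1: "E d * (a - b) = s * (a - p) * (d - b)"
    using affine_fun_Lagrange[OF aE, of d a b] E0 Ds by simp
  have N1: "N d * (x - y) = s * (x - p) * (d - y)"
    using affine_fun_Lagrange[OF aN, of d x y] N0 Ds by simp
  have "(a - p) * (d - b) * (x - y) = (x - p) * (d - y) * (a - b)"
    using hex by algebra
  then have "E d * ((a - b) * (x - y)) = N d * ((a - b) * (x - y))"
    using E1 N1 by algebra
  then have "E d = N d" using ne by simp
  then show ?thesis unfolding E_def N_def by simp
qed

text \<open>Puts the condition \<open>D c = 0\<close> into a form free of the center
  \<open>c\<close>: equidistance expresses the ratio of \<open>x - c\<close> to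
  \<open>y - c\<close>, hence that of \<open>D x\<close> to \<open>D y\<close>, through the other
  points. This form reappears as \<open>hinged\<close>.\<close>

lemma hinge_of_center:
  assumes "affine_fun D" "D c = 0"
    and "dist a p = dist a x" "dist b p = dist b y" "dist c p = dist c x" "dist c p = dist c y"
    and ne: "x \<noteq> p" "y \<noteq> p"
  shows "cnj (a - p) * (y - b) * D x = cnj (b - p) * (x - a) * D y"
proof -
  obtain k s where cs: "\<And>z. D z = k + s * z"
    using assms(1) unfolding affine_fun_def by metis
  have Ds: "D z = s * (z - c)" for z
    using assms(2) cs[of z] cs[of c] by (simp add: algebra_simps)
  note e = assms(3-6)[THEN equidistant_cnj]
  have "(cnj (a - p) * (y - b) * (x - c)) * ((x - p) * (y - p) * cnj (x - p) * cnj (y - p))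
      = ((x - p) * cnj (a - p)) * ((y - b) * cnj (y - p)) * ((x - c) * cnj (x - p)) * (y - p)"
    by (simp only: ac_simps)
  also have "\<dots> = ((x - a) * cnj (x - p)) * ((y - p) * cnj (b - p)) * ((x - p) * cnj (c - p)) * (y - p)"
    by (simp only: e)
  also have "\<dots> = (cnj (b - p) * (x - a)) * ((y - p) * cnj (c - p)) * (x - p) * (y - p) * cnj (x - p)"
    by (simp only: ac_simps)
  also have "\<dots> = (cnj (b - p) * (x - a)) * ((y - c) * cnj (y - p)) * (x - p) * (y - p) * cnj (x - p)"
    by (simp only: e)
  also have "\<dots> = (cnj (b - p) * (x - a) * (y - c)) * ((x - p) * (y - p) * cnj (x - p) * cnj (y - p))"
    by (simp only: ac_simps)
  finally have "cnj (a - p) * (y - b) * (x - c) = cnj (b - p) * (x - a) * (y - c)"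
    using ne by simp
  then show ?thesis unfolding Ds by algebra
qed

text \<open>The second octahedron. The hinge condition stands in for agreement of \<open>f\<close>
  and \<open>f'\<close> at a circle center, and the last vertex lies over \<open>q\<close>, the
  mirror image of \<open>p\<close> in the line through \<open>a\<close> and
  \<open>b\<close>.\<close>

lemma hinge_affine:
  assumes aff: "affine_fun f" "affine_fun f'" "affine_fun g" "affine_fun h"
    and ne: "a \<noteq> b" "x \<noteq> y" "q \<noteq> p" "b \<noteq> p"
    and hinge: "cnj (a - p) * (y - b) * (f x - f' x) = cnj (b - p) * (x - a) * (f y - f' y)"
    and q: "dist a p = dist a q" "dist b p = dist b q"
    and g: "g a = f a" "g b = f' b" and h: "h x = f x" "h y = f' y"
  shows "g q = h q"
proof -
  define D where "D = (\<lambda>z. f z - f' z)"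
  define E where "E = (\<lambda>z. g z - f' z)"
  define N where "N = (\<lambda>z. h z - f' z)"
  have aD: "affine_fun D" and aE: "affine_fun E" and aN: "affine_fun N"
    unfolding D_def E_def N_def using aff by (auto intro: affine_fun_diff)
  have E0: "E b = 0" "E a = D a" and N0: "N y = 0" "N x = D x"
    unfolding D_def E_def N_def using g h by auto
  define \<alpha> \<beta> where "\<alpha> = cnj (a - p)" and "\<beta> = cnj (b - p)"
  have b0: "\<beta> \<noteq> 0" using ne unfolding \<beta>_def by simp
  have "(q - a) * cnj (q - p) = (q - p) * \<alpha>" "(q - b) * cnj (q - p) = (q - p) * \<beta>"
    unfolding \<alpha>_def \<beta>_def using q[THEN equidistant_cnj] by simp_all
  then have "(q - a) * \<beta> * ((q - p) * cnj (q - p)) = (q - b) * \<alpha> * ((q - p) * cnj (q - p))"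
    by algebra
  \<comment> \<open>Reflection in the line through \<open>a\<close> and \<open>b\<close> conjugates
    the ratio of the differences to \<open>a\<close> and \<open>b\<close>.\<close>
  then have 1: "(q - a) * \<beta> = (q - b) * \<alpha>"
    using ne by simp
  have 2: "\<alpha> * (y - b) * D x = \<beta> * (x - a) * D y"
    using hinge unfolding \<alpha>_def \<beta>_def D_def .
  have 3: "D a * (x - y) = D x * (a - y) - D y * (a - x)"
    by (rule affine_fun_Lagrange[OF aD])
  have 4: "E q * (a - b) = D a * (q - b)"
    using affine_fun_Lagrange[OF aE, of q a b] E0 by simp
  have 5: "N q * (x - y) = D x * (q - y)"
    using affine_fun_Lagrange[OF aN, of q x y] N0 by simp
  have "\<beta> * (D a * (x - y) * (q - b)) = \<beta> * (D x * (q - y) * (a - b))"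
    using 1 2 3 by algebra
  then have "D a * (x - y) * (q - b) = D x * (q - y) * (a - b)" using b0 by simp
  then have "E q * ((a - b) * (x - y)) = N q * ((a - b) * (x - y))"
    using 4 5 by algebra
  then have "E q = N q" using ne by simp
  then show ?thesis unfolding E_def N_def by simp
qed

section \<open>Nondegeneracy contained in the two propagation relations\<close>

lemma other_intersectionD:
  assumes "other_intersection a b p q"
  shows "a \<noteq> b" "q \<noteq> p" "dist a p = dist a q" "dist b p = dist b q"
proof -
  have 1: "sphere a (dist a p) \<inter> sphere b (dist b p) = {p, q}" and 2: "q \<noteq> p"
    using assms unfolding other_intersection_def by auto
  show "q \<noteq> p" by fact
  have "q \<in> sphere a (dist a p) \<inter> sphere b (dist b p)" unfolding 1 by simp
  then show "dist a p = dist a q" "dist b p = dist b q" by (auto simp: dist_commute)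
  show "a \<noteq> b"
  proof
    assume "a = b"
    then have s: "sphere a (dist a p) = {p, q}" using 1 by simp
    \<comment> \<open>The antipode of \<open>p\<close> and a point a quarter turn away: a circle of
      positive radius has more than two points.\<close>
    have "a + (a - p) \<in> sphere a (dist a p)" "a + \<i> * (a - p) \<in> sphere a (dist a p)"
      by (auto simp: dist_norm norm_mult norm_minus_commute)
    then have m: "a + (a - p) \<in> {p, q}" "a + \<i> * (a - p) \<in> {p, q}" unfolding s by auto
    have ap: "a \<noteq> p" using s 2 by auto
    have "a + (a - p) \<noteq> p" using ap by (simp add: algebra_simps)
    then have q: "q = a + (a - p)" using m by auto
    have "a + \<i> * (a - p) \<noteq> p"
    proof
      assume "a + \<i> * (a - p) = p"
      then have "(1 + \<i>) * (a - p) = 0" by (simp add: algebra_simps)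
      then show False using ap by (auto simp: complex_eq_iff)
    qed
    moreover have "a + \<i> * (a - p) \<noteq> q"
    proof
      assume "a + \<i> * (a - p) = q"
      then have "(1 - \<i>) * (a - p) = 0" unfolding q by (simp add: algebra_simps)
      then show False using ap by (auto simp: complex_eq_iff)
    qed
    ultimately show False using m by auto
  qed
qed

lemma ex_two_equidistant:
  fixes x y :: complex
  obtains c c' where "c \<noteq> c'" "dist c x = dist c y" "c \<noteq> x" "dist c' x = dist c' y" "c' \<noteq> x"
proof (cases "x = y")
  case True
  show ?thesis by (rule that[of "x + 1" "x + 2"]) (auto simp: True dist_norm)
next
  case False
  \<comment> \<open>Parametrizes the perpendicular bisector by real \<open>k\<close>;
    \<open>k = 0\<close> is the midpoint.\<close>
  define c where "c k = (x + y) / 2 + k * \<i> * (x - y)" for k :: complex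
  have e1: "c k - x = (k * \<i> - 1 / 2) * (x - y)" for k unfolding c_def by (simp add: field_simps)
  have e2: "c k - y = (k * \<i> + 1 / 2) * (x - y)" for k unfolding c_def by (simp add: field_simps)
  have "dist (c (of_real k)) x = dist (c (of_real k)) y" for k
    unfolding dist_norm e1 e2 norm_mult by (simp add: cmod_def)
  moreover have "c (of_real k) \<noteq> x" for k
  proof -
    have "c (of_real k) - x \<noteq> 0"
      unfolding e1 using False by (auto dest: arg_cong[of _ _ Re])
    then show ?thesis by simp
  qed
  moreover have "c (of_real 0) \<noteq> c (of_real 1)" unfolding c_def using False by simp
  ultimately show ?thesis using that by blast
qed

lemma ex_circle_with_center_iff:
  "(\<exists>C. circle_with_center c C \<and> {x, y, u} \<subseteq> C) \<longleftrightarrow>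
     dist c u = dist c x \<and> dist c u = dist c y \<and> c \<noteq> u" (is "?L \<longleftrightarrow> ?R")
proof
  assume ?L
  then obtain r where "r > 0" "dist c x = r" "dist c y = r" "dist c u = r"
    unfolding circle_with_center_def by auto
  then show ?R by auto
next
  assume ?R
  then have "circle_with_center c (sphere c (dist c u))" "{x, y, u} \<subseteq> sphere c (dist c u)"
    unfolding circle_with_center_def by (auto intro!: exI[of _ "dist c u"])
  then show ?L by blast
qed

text \<open>Distinctness comes from uniqueness: if two of the three points coincided, only two
  points would constrain the circle, and \<open>ex_two_equidistant\<close> would supply a second
  center.\<close>

lemma center_of_circle_throughD:
  assumes "center_of_circle_through x y u c"
  shows "dist c u = dist c x" "dist c u = dist c y" "c \<noteq> u" "x \<noteq> y" "x \<noteq> u" "y \<noteq> u"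
proof -
  have ex: "\<exists>C. circle_with_center c C \<and> {x, y, u} \<subseteq> C"
    using assms unfolding center_of_circle_through_def by blast
  have all: "c' = c" if "\<exists>C. circle_with_center c' C \<and> {x, y, u} \<subseteq> C" for c'
    using assms that unfolding center_of_circle_through_def by blast
  show "dist c u = dist c x" "dist c u = dist c y" "c \<noteq> u"
    using ex unfolding ex_circle_with_center_iff by auto
  have uniq: "c1 = c2" if "dist c1 u = dist c1 x" "dist c1 u = dist c1 y" "c1 \<noteq> u"
     "dist c2 u = dist c2 x" "dist c2 u = dist c2 y" "c2 \<noteq> u" for c1 c2
    using all[of c1] all[of c2] that unfolding ex_circle_with_center_iff by blast
  obtain c1 c2 where "c1 \<noteq> c2" "dist c1 u = dist c1 x" "c1 \<noteq> u"
     "dist c2 u = dist c2 x" "c2 \<noteq> u" by (metis ex_two_equidistant)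
  then show "x \<noteq> y" "y \<noteq> u" using uniq[of c1 c2] by auto
  obtain c1 c2 where "c1 \<noteq> c2" "dist c1 u = dist c1 y" "c1 \<noteq> u"
     "dist c2 u = dist c2 y" "c2 \<noteq> u" by (metis ex_two_equidistant)
  then show "x \<noteq> u" using uniq[of c1 c2] by auto
qed

section \<open>Circle invariants of the rows and the linear problem\<close>

definition centered_row :: "(int \<Rightarrow> nat \<Rightarrow> complex) \<Rightarrow> (int \<Rightarrow> nat \<Rightarrow> complex) \<Rightarrow> nat \<Rightarrow> bool" where
  "centered_row x y j \<longleftrightarrow> (\<forall>i. even i \<noteq> even j \<longrightarrow>
     x i (j + 1) \<noteq> y i (j + 1) \<and>
     dist (x i (j + 1)) (x (i - 1) j) = dist (x i (j + 1)) (y i (j + 1)) \<and>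
     dist (x i (j + 1)) (x (i + 1) j) = dist (x i (j + 1)) (y i (j + 1)))"

text \<open>Concerns the circles centered in row \<open>j\<close>, whereas
  \<open>centered_row\<close> covers those centered in row \<open>j + 1\<close>. For singular data
  the inequalities can fail in row \<open>0\<close>; every propagation step establishes them for the
  next row.\<close>

definition inscribed_row :: "(int \<Rightarrow> nat \<Rightarrow> complex) \<Rightarrow> (int \<Rightarrow> nat \<Rightarrow> complex) \<Rightarrow> nat \<Rightarrow> bool" where
  "inscribed_row x y j \<longleftrightarrow> (\<forall>i. even i = even j \<longrightarrow>
     x i j \<noteq> y (i - 1) (j + 1) \<and> x i j \<noteq> y (i + 1) (j + 1) \<and>
     dist (y i j) (x i j) = dist (y i j) (y (i - 1) (j + 1)) \<and>
     dist (y i j) (x i j) = dist (y i j) (y (i + 1) (j + 1)))"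

type_synonym affine_family = "int \<Rightarrow> int \<Rightarrow> complex \<Rightarrow> complex"

definition agree :: "(int \<Rightarrow> nat \<Rightarrow> complex) \<Rightarrow> nat \<Rightarrow> affine_family \<Rightarrow> bool" where
  "agree x j U \<longleftrightarrow>
     (\<forall>i n. even i = even j \<longrightarrow> U (i - 1) n (x i j) = U (i + 1) n (x i j))"

text \<open>When the center \<open>y i j\<close> is determined by the points around it, the following says that the
  functions at \<open>i - 1\<close> and \<open>i + 1\<close> agree there. It keeps its meaning if one of these points
  coincides with \<open>x i j\<close>, as can happen in row \<open>0\<close>, where the prescribed center need not be the
  limit of the generic one.\<close>

definition hinged ::
  "(int \<Rightarrow> nat \<Rightarrow> complex) \<Rightarrow> (int \<Rightarrow> nat \<Rightarrow> complex) \<Rightarrow> nat \<Rightarrow> affine_family \<Rightarrow> bool" where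
  "hinged x y j V \<longleftrightarrow> (\<forall>i n. even i = even j \<longrightarrow>
     cnj (x (i - 1) (j + 1) - x i j) * (y (i + 1) (j + 1) - x (i + 1) (j + 1)) *
       (V (i - 1) n (y (i - 1) (j + 1)) - V (i + 1) n (y (i - 1) (j + 1))) =
     cnj (x (i + 1) (j + 1) - x i j) * (y (i - 1) (j + 1) - x (i - 1) (j + 1)) *
       (V (i - 1) n (y (i + 1) (j + 1)) - V (i + 1) n (y (i + 1) (j + 1))))"

text \<open>\<open>U i n\<close> is the coefficient of \<open>\<lambda>\<^sup>n\<close>; negative \<open>n\<close> occur because the index of one of the
  two families is shifted whenever the roles of \<open>x\<close> and \<open>y\<close> are exchanged.\<close>

definition lax_solution ::
  "(int \<Rightarrow> nat \<Rightarrow> complex) \<Rightarrow> (int \<Rightarrow> nat \<Rightarrow> complex) \<Rightarrow> nat \<Rightarrow>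
   affine_family \<Rightarrow> affine_family \<Rightarrow> bool" where
  "lax_solution x y j U V \<longleftrightarrow>
     (\<forall>i n. affine_fun (U i n) \<and> affine_fun (V i n)) \<and>
     (\<forall>i n. even i \<noteq> even j \<longrightarrow>
        U i n (x i (j + 1)) = V i n (x i (j + 1)) \<and>
        U i (n + 1) (y i (j + 1)) = V i n (y i (j + 1))) \<and>
     agree x j U"

text \<open>Bounds the exponents of \<lambda>. Functions attached to row \<open>j\<close> are
  indexed by the positions of row \<open>j + 1\<close>, hence the parity.\<close>

definition supported :: "nat \<Rightarrow> int \<Rightarrow> int \<Rightarrow> affine_family \<Rightarrow> bool" where
  "supported j a b U \<longleftrightarrow> (\<forall>i n. even i \<noteq> even j \<longrightarrow> n \<notin> {a..b} \<longrightarrow> U i n = (\<lambda>_. 0))"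

definition interpolate_row ::
  "(int \<Rightarrow> nat \<Rightarrow> complex) \<Rightarrow> nat \<Rightarrow> affine_family \<Rightarrow> affine_family" where
  "interpolate_row x j U i n =
     interpolate (x (i - 1) j) (U (i - 1) n (x (i - 1) j)) (x (i + 1) j) (U (i + 1) n (x (i + 1) j))"

lemma propagation_rowD:
  assumes "propagation_row x y j" "even i = even j"
  shows "other_intersection (x (i - 1) (j + 1)) (x (i + 1) (j + 1)) (x i j) (x i (j + 2))"
    and "center_of_circle_through (y (i - 1) (j + 1)) (y (i + 1) (j + 1)) (x i (j + 2)) (y i (j + 2))"
  using assms unfolding propagation_row_def by auto

text \<open>The circle around \<open>x i (j + 1)\<close> contains the new points on both sides,
  since each is an intersection of it with a neighboring circle, and it contains
  \<open>y i (j + 1)\<close> by the old invariant. Thus \<open>x\<close> and \<open>y\<close>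
  exchange roles.\<close>

lemma propagation_row_invariants:
  assumes step: "propagation_row x y j" and cen: "centered_row x y j"
  shows "centered_row y x (j + 1)" "inscribed_row y x (j + 1)"
proof -
  show "centered_row y x (j + 1)"
    unfolding centered_row_def
  proof (intro allI impI)
    fix i :: int assume "even i \<noteq> even (j + 1)"
    then have "even i = even j" by auto
    note D = center_of_circle_throughD[OF propagation_rowD(2)[OF step this]]
    show "y i (j + 1 + 1) \<noteq> x i (j + 1 + 1) \<and>
      dist (y i (j + 1 + 1)) (y (i - 1) (j + 1)) = dist (y i (j + 1 + 1)) (x i (j + 1 + 1)) \<and>
      dist (y i (j + 1 + 1)) (y (i + 1) (j + 1)) = dist (y i (j + 1 + 1)) (x i (j + 1 + 1))"
      using D by simp
  qed
  show "inscribed_row y x (j + 1)"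
    unfolding inscribed_row_def
  proof (intro allI impI)
    fix i :: int assume "even i = even (j + 1)"
    then have p: "even i \<noteq> even j" "even (i - 1) = even j" "even (i + 1) = even j" by auto
    note l = propagation_rowD[OF step p(2)] and r = propagation_rowD[OF step p(3)]
    note dl = other_intersectionD[OF l(1)] center_of_circle_throughD[OF l(2)]
    note dr = other_intersectionD[OF r(1)] center_of_circle_throughD[OF r(2)]
    show "y i (j + 1) \<noteq> x (i - 1) (j + 1 + 1) \<and> y i (j + 1) \<noteq> x (i + 1) (j + 1 + 1) \<and>
      dist (x i (j + 1)) (y i (j + 1)) = dist (x i (j + 1)) (x (i - 1) (j + 1 + 1)) \<and>
      dist (x i (j + 1)) (y i (j + 1)) = dist (x i (j + 1)) (x (i + 1) (j + 1 + 1))"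
      using dl dr cen p(1) unfolding centered_row_def by simp
  qed
qed

section \<open>Propagation of solutions of the linear problem\<close>

lemma hinged_if_agree:
  assumes "lax_solution x y j U V" "agree y j V" "centered_row x y j" "inscribed_row x y j"
  shows "hinged x y j V"
  unfolding hinged_def
proof (intro allI impI)
  fix i n :: int assume i: "even i = even j"
  then have p: "even (i - 1) \<noteq> even j" "even (i + 1) \<noteq> even j" by auto
  have aff: "affine_fun (\<lambda>z. V (i - 1) n z - V (i + 1) n z)"
    using assms(1) unfolding lax_solution_def by (auto intro: affine_fun_diff)
  have 0: "V (i - 1) n (y i j) - V (i + 1) n (y i j) = 0"
    using assms(2) i unfolding agree_def by simp
  have l: "dist (x (i - 1) (j + 1)) (x i j) = dist (x (i - 1) (j + 1)) (y (i - 1) (j + 1))"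
    using assms(3) p(1) unfolding centered_row_def by (metis diff_add_cancel)
  have r: "dist (x (i + 1) (j + 1)) (x i j) = dist (x (i + 1) (j + 1)) (y (i + 1) (j + 1))"
    using assms(3) p(2) unfolding centered_row_def by (metis add_diff_cancel)
  note I = assms(4)[unfolded inscribed_row_def, rule_format, OF i]
  from hinge_of_center[OF aff 0 l r] I
  show "cnj (x (i - 1) (j + 1) - x i j) * (y (i + 1) (j + 1) - x (i + 1) (j + 1)) *
       (V (i - 1) n (y (i - 1) (j + 1)) - V (i + 1) n (y (i - 1) (j + 1))) =
     cnj (x (i + 1) (j + 1) - x i j) * (y (i - 1) (j + 1) - x (i - 1) (j + 1)) *
       (V (i - 1) n (y (i + 1) (j + 1)) - V (i + 1) n (y (i + 1) (j + 1)))"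
    by metis
qed

lemma interpolate_row_agree:
  assumes "\<And>i. even i = even j \<Longrightarrow> x (i - 1) j' \<noteq> x (i + 1) j'" "even k \<noteq> even j"
  shows "interpolate_row x j' U (k - 1) n (x k j') = U k n (x k j')"
    and "interpolate_row x j' U (k + 1) n (x k j') = U k n (x k j')"
  using assms(1)[of "k - 1"] assms(1)[of "k + 1"] assms(2)
  by (auto simp: interpolate_row_def interpolate_left interpolate_right)

text \<open>Agreement of \<open>U\<close> at \<open>x i j\<close> yields the relation at the new
  center \<open>y i (j + 2)\<close> through \<open>menelaus_affine\<close>; the hinge condition on
  \<open>V\<close> yields the one at the new point \<open>x i (j + 2)\<close> through
  \<open>hinge_affine\<close>. As \<open>x\<close> and \<open>y\<close> exchange roles,
  \<open>V'\<close> comes first and \<open>U'\<close> is divided by \<lambda>.\<close>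

lemma lax_solution_propagate:
  fixes U V :: affine_family
  assumes step: "propagation_row x y j" and cen: "centered_row x y j"
    and lax: "lax_solution x y j U V" and hinge: "hinged x y j V"
  defines "U' \<equiv> interpolate_row x (j + 1) U" and "V' \<equiv> interpolate_row y (j + 1) V"
  shows "lax_solution y x (j + 1) V' (\<lambda>i n. U' i (n + 1))"
    and "agree x (j + 1) (\<lambda>i n. U' i (n + 1))"
proof -
  have xne: "x (i - 1) (j + 1) \<noteq> x (i + 1) (j + 1)" if "even i = even j" for i
    using other_intersectionD(1)[OF propagation_rowD(1)[OF step that]] .
  have yne: "y (i - 1) (j + 1) \<noteq> y (i + 1) (j + 1)" if "even i = even j" for i
    using center_of_circle_throughD(4)[OF propagation_rowD(2)[OF step that]] .
  have U': "U' (k - 1) n (x k (j + 1)) = U k n (x k (j + 1))"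
      "U' (k + 1) n (x k (j + 1)) = U k n (x k (j + 1))" if "even k \<noteq> even j" for k n
    unfolding U'_def using xne that by (blast intro!: interpolate_row_agree)+
  have V': "V' (k - 1) n (y k (j + 1)) = V k n (y k (j + 1))"
      "V' (k + 1) n (y k (j + 1)) = V k n (y k (j + 1))" if "even k \<noteq> even j" for k n
    unfolding V'_def using yne that by (blast intro!: interpolate_row_agree)+
  have aff: "affine_fun (U i n)" "affine_fun (V i n)" "affine_fun (U' i n)" "affine_fun (V' i n)"
    for i n
    using lax unfolding lax_solution_def U'_def V'_def interpolate_row_def by auto
  have T: "U i n (x i (j + 1)) = V i n (x i (j + 1))"
      "U i (n + 1) (y i (j + 1)) = V i n (y i (j + 1))" if "even i \<noteq> even j" for i n
    using lax that unfolding lax_solution_def by auto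
  have ag: "U (i - 1) n (x i j) = U (i + 1) n (x i j)" if "even i = even j" for i n
    using lax that unfolding lax_solution_def agree_def by auto
  show "agree x (j + 1) (\<lambda>i n. U' i (n + 1))"
    unfolding agree_def using U' by auto
  have ag': "agree y (j + 1) V'"
    unfolding agree_def using V' by auto
  have new: "V' i n (y i (j + 2)) = U' i (n + 1) (y i (j + 2)) \<and>
      V' i n (x i (j + 2)) = U' i n (x i (j + 2))" if i: "even i = even j" for i n
  proof -
    have p: "even (i - 1) \<noteq> even j" "even (i + 1) \<noteq> even j" using i by auto
    note q = other_intersectionD[OF propagation_rowD(1)[OF step i]]
    note d = center_of_circle_throughD[OF propagation_rowD(2)[OF step i]]
    have l: "dist (x (i - 1) (j + 1)) (x i j) = dist (x (i - 1) (j + 1)) (y (i - 1) (j + 1))"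
      using cen p(1) unfolding centered_row_def by (metis diff_add_cancel)
    have r: "dist (x (i + 1) (j + 1)) (x i j) = dist (x (i + 1) (j + 1)) (y (i + 1) (j + 1))"
      using cen p(2) unfolding centered_row_def by (metis add_diff_cancel)
    have ne: "x (i + 1) (j + 1) \<noteq> x i j"
      using r cen p(2) unfolding centered_row_def by (metis dist_eq_0_iff)
    \<comment> \<open>The new point is common to the three circles centered at the two
      \<open>x\<close> neighbors and at \<open>y i (j + 2)\<close>.\<close>
    have hex: "(x i j - x (i - 1) (j + 1)) * (y (i + 1) (j + 1) - x (i + 1) (j + 1)) *
        (y (i - 1) (j + 1) - y i (j + 2)) =
      (y (i - 1) (j + 1) - x (i - 1) (j + 1)) * (x i j - x (i + 1) (j + 1)) *
        (y (i + 1) (j + 1) - y i (j + 2))"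
      by (rule circumcenters_hexagon[where q = "x i (j + 2)"])
        (use q d l r in \<open>simp_all add: dist_commute\<close>)
    have Ua: "U' i n (x (i - 1) (j + 1)) = U (i - 1) n (x (i - 1) (j + 1))"
        "U' i n (x (i + 1) (j + 1)) = U (i + 1) n (x (i + 1) (j + 1))" for n
      using U'(2)[OF p(1)] U'(1)[OF p(2)] by simp_all
    have Vx: "V' i n (y (i - 1) (j + 1)) = V (i - 1) n (y (i - 1) (j + 1))"
        "V' i n (y (i + 1) (j + 1)) = V (i + 1) n (y (i + 1) (j + 1))" for n
      using V'(2)[OF p(1)] V'(1)[OF p(2)] by simp_all
    note T' = T[OF p(1)] T[OF p(2)]
    have "U' i (n + 1) (y i (j + 2)) = V' i n (y i (j + 2))"
      by (rule menelaus_affine[OF aff(1) aff(1) aff(3) aff(4) q(1) d(4) ag[OF i] Ua _ _ hex])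
        (simp_all only: Vx T')
    moreover have "U' i n (x i (j + 2)) = V' i n (x i (j + 2))"
      by (rule hinge_affine[OF aff(2) aff(2) aff(3) aff(4) q(1) d(4) q(2) ne _ q(3,4) _ _ Vx,
            OF hinge[unfolded hinged_def, rule_format, OF i]])
        (simp_all only: Ua T')
    ultimately show ?thesis by simp
  qed
  show "lax_solution y x (j + 1) V' (\<lambda>i n. U' i (n + 1))"
    unfolding lax_solution_def using aff ag' new by (auto simp: add.commute)
qed

section \<open>Degree reduction and nonvanishing\<close>

lemma supported_zero:
  "supported j a b U \<Longrightarrow> even i \<noteq> even j \<Longrightarrow> n \<notin> {a..b} \<Longrightarrow> U i n = (\<lambda>_. 0)"
  unfolding supported_def by blast

lemma lax_solution_swap:
  assumes "lax_solution x y j U V" "even i \<noteq> even j"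
  shows "U i n (x i (j + 1)) = V i n (x i (j + 1))"
    and "U i (n + 1) (y i (j + 1)) = V i n (y i (j + 1))"
  using assms unfolding lax_solution_def by auto

text \<open>Only values shared by both families enter the interpolation: at \<open>x\<close> with
  equal exponents, at \<open>y\<close> with exponents shifted by one. An exponent survives only if
  both supports allow it, which is where the degree drops.\<close>

lemma supported_interpolate_row:
  assumes "lax_solution x y j U V" "supported j a b U" "supported j c d V"
  shows "supported (j + 1) (max a c) (min b d) (interpolate_row x (j + 1) U)"
    and "supported (j + 1) (max c (a - 1)) (min d (b - 1)) (interpolate_row y (j + 1) V)"
proof -
  have ev: "U k n (x k (j + 1)) = 0" if "even k \<noteq> even j" "n \<notin> {max a c..min b d}" for k n
    using lax_solution_swap(1)[OF assms(1) that(1), of n] supported_zero[OF assms(2) that(1), of n]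
      supported_zero[OF assms(3) that(1), of n] that(2) by fastforce
  show "supported (j + 1) (max a c) (min b d) (interpolate_row x (j + 1) U)"
    unfolding supported_def interpolate_row_def
  proof (intro allI impI)
    fix i n :: int
    assume "even i \<noteq> even (j + 1)" and n: "n \<notin> {max a c..min b d}"
    then have p: "even (i - 1) \<noteq> even j" "even (i + 1) \<noteq> even j" by auto
    show "interpolate (x (i - 1) (j + 1)) (U (i - 1) n (x (i - 1) (j + 1)))
        (x (i + 1) (j + 1)) (U (i + 1) n (x (i + 1) (j + 1))) = (\<lambda>_. 0)"
      unfolding ev[OF p(1) n] ev[OF p(2) n] by (rule interpolate_zero)
  qed
  have ev: "V k n (y k (j + 1)) = 0" if "even k \<noteq> even j" "n \<notin> {max c (a - 1)..min d (b - 1)}" for k n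
    using lax_solution_swap(2)[OF assms(1) that(1), of n] supported_zero[OF assms(2) that(1), of "n + 1"]
      supported_zero[OF assms(3) that(1), of n] that(2) by fastforce
  show "supported (j + 1) (max c (a - 1)) (min d (b - 1)) (interpolate_row y (j + 1) V)"
    unfolding supported_def interpolate_row_def
  proof (intro allI impI)
    fix i n :: int
    assume "even i \<noteq> even (j + 1)" and n: "n \<notin> {max c (a - 1)..min d (b - 1)}"
    then have p: "even (i - 1) \<noteq> even j" "even (i + 1) \<noteq> even j" by auto
    show "interpolate (y (i - 1) (j + 1)) (V (i - 1) n (y (i - 1) (j + 1)))
        (y (i + 1) (j + 1)) (V (i + 1) n (y (i + 1) (j + 1))) = (\<lambda>_. 0)"
      unfolding ev[OF p(1) n] ev[OF p(2) n] by (rule interpolate_zero)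
  qed
qed

lemma supported_shift: "supported j a b U \<Longrightarrow> supported j (a - 1) (b - 1) (\<lambda>i n. U i (n + 1))"
  unfolding supported_def by auto

lemma supported_mono:
  assumes "supported j a b U" "a' \<le> a" "b \<le> b'"
  shows "supported j a' b' U"
proof -
  have "n \<notin> {a..b}" if "n \<notin> {a'..b'}" for n
    using assms(2,3) that by auto
  then show ?thesis using assms(1) unfolding supported_def by blast
qed

definition vanishing :: "nat \<Rightarrow> affine_family \<Rightarrow> bool" where
  "vanishing j U \<longleftrightarrow> (\<forall>i n. even i \<noteq> even j \<longrightarrow> U i n = (\<lambda>_. 0))"

text \<open>Propagation loses nothing: an affine function of row \<open>j\<close> is fixed by its
  values at the distinct points \<open>x i (j + 1)\<close> and \<open>y i (j + 1)\<close>.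
  Interpolation retains one of them, and the relations with the other family give the
  second.\<close>

lemma vanishing_if_interpolate_row:
  assumes step: "propagation_row x y j" and cen: "centered_row x y j"
    and lax: "lax_solution x y j U V"
    and van: "vanishing (j + 1) (interpolate_row x (j + 1) U)"
      "vanishing (j + 1) (interpolate_row y (j + 1) V)"
  shows "vanishing j U" "vanishing j V"
proof -
  have "U i n = (\<lambda>_. 0) \<and> V i n = (\<lambda>_. 0)" if i: "even i \<noteq> even j" for i n
  proof -
    have xne: "x (k - 1) (j + 1) \<noteq> x (k + 1) (j + 1)" if "even k = even j" for k
      using other_intersectionD(1)[OF propagation_rowD(1)[OF step that]] .
    have yne: "y (k - 1) (j + 1) \<noteq> y (k + 1) (j + 1)" if "even k = even j" for k
      using center_of_circle_throughD(4)[OF propagation_rowD(2)[OF step that]] .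
    have i': "even (i - 1) \<noteq> even (j + 1)" using i by auto
    have u: "U i n (x i (j + 1)) = 0" for n
      using interpolate_row_agree(1)[of j x "j + 1" i U n, OF xne i] van(1) i'
      unfolding vanishing_def by metis
    have v: "V i n (y i (j + 1)) = 0" for n
      using interpolate_row_agree(1)[of j y "j + 1" i V n, OF yne i] van(2) i'
      unfolding vanishing_def by metis
    have aff: "affine_fun (U i n)" "affine_fun (V i n)"
      using lax unfolding lax_solution_def by auto
    have "x i (j + 1) \<noteq> y i (j + 1)"
      using cen i unfolding centered_row_def by blast
    moreover have "U i n (y i (j + 1)) = 0"
      using lax_solution_swap(2)[OF lax i, of "n - 1"] v by simp
    moreover have "V i n (x i (j + 1)) = 0"
      using lax_solution_swap(1)[OF lax i, of n] u by simp
    ultimately show ?thesis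
      using affine_fun_eqI[OF aff(1) affine_fun_zero, of "x i (j + 1)" "y i (j + 1)"]
        affine_fun_eqI[OF aff(2) affine_fun_zero, of "x i (j + 1)" "y i (j + 1)"] u v by simp
  qed
  then show "vanishing j U" "vanishing j V" unfolding vanishing_def by auto
qed

lemma vanishing_shift: "vanishing j (\<lambda>i n. U i (n + 1)) \<longleftrightarrow> vanishing j U"
  unfolding vanishing_def by (metis diff_add_cancel)

text \<open>A single step shortens only one of the two supports and exchanges \<open>x\<close> and
  \<open>y\<close>; two steps shorten both and restore the roles.\<close>

lemma lax_solution_propagate_twice:
  assumes step: "propagation_row x y j" "propagation_row y x (j + 1)"
    and cen: "centered_row x y j" and lax: "lax_solution x y j U V" and hinge: "hinged x y j V"
    and supp: "supported j l (l + d) U" "supported j l (l + d) V"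
    and nonzero: "\<not> (vanishing j U \<and> vanishing j V)"
  obtains U' V' where "lax_solution x y (j + 2) U' V'" "agree y (j + 2) V'" "hinged x y (j + 2) V'"
    "supported (j + 2) (l - 1) (l - 1 + (d - 1)) U'" "supported (j + 2) (l - 1) (l - 1 + (d - 1)) V'"
    "\<not> (vanishing (j + 2) U' \<and> vanishing (j + 2) V')"
proof -
  define U1 where "U1 = interpolate_row x (j + 1) U"
  define V1 where "V1 = interpolate_row y (j + 1) V"
  define V1s where "V1s = (\<lambda>i n. U1 i (n + 1))"
  have lax1: "lax_solution y x (j + 1) V1 V1s" and ag1: "agree x (j + 1) V1s"
    using lax_solution_propagate[OF step(1) cen lax hinge] unfolding U1_def V1_def V1s_def .
  have cen1: "centered_row y x (j + 1)" "inscribed_row y x (j + 1)"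
    by (rule propagation_row_invariants[OF step(1) cen])+
  have hinge1: "hinged y x (j + 1) V1s"
    by (rule hinged_if_agree[OF lax1 ag1 cen1])
  \<comment> \<open>\<open>V1\<close> has lost its top exponent; the division of \<open>U1\<close>
    by \<lambda> then moves the other support down to \<open>l - 1\<close>.\<close>
  have "supported (j + 1) l (l + d) U1" "supported (j + 1) l (l + (d - 1)) V1"
    using supported_interpolate_row[OF lax supp] unfolding U1_def V1_def
    by (auto elim!: supported_mono)
  then have supp1: "supported (j + 1) l (l + (d - 1)) V1" "supported (j + 1) (l - 1) (l + d - 1) V1s"
    unfolding V1s_def by (auto dest: supported_shift)
  have nonzero1: "\<not> (vanishing (j + 1) V1 \<and> vanishing (j + 1) V1s)"
    using vanishing_if_interpolate_row[OF step(1) cen lax] nonzero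
    unfolding V1s_def vanishing_shift U1_def V1_def by blast
  define U2 where "U2 = interpolate_row y (j + 1 + 1) V1"
  define V2 where "V2 = interpolate_row x (j + 1 + 1) V1s"
  define V2s where "V2s = (\<lambda>i n. U2 i (n + 1))"
  have lax2: "lax_solution x y (j + 1 + 1) V2 V2s" and ag2: "agree y (j + 1 + 1) V2s"
    using lax_solution_propagate[OF step(2) cen1(1) lax1 hinge1] unfolding U2_def V2_def V2s_def .
  have cen2: "centered_row x y (j + 1 + 1)" "inscribed_row x y (j + 1 + 1)"
    by (rule propagation_row_invariants[OF step(2) cen1(1)])+
  have hinge2: "hinged x y (j + 1 + 1) V2s"
    by (rule hinged_if_agree[OF lax2 ag2 cen2])
  have "supported (j + 1 + 1) l (l + (d - 1)) U2" "supported (j + 1 + 1) (l - 1) (l - 1 + (d - 1)) V2"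
    using supported_interpolate_row[OF lax1 supp1] unfolding U2_def V2_def
    by (auto elim!: supported_mono)
  then have supp2: "supported (j + 1 + 1) (l - 1) (l - 1 + (d - 1)) V2"
      "supported (j + 1 + 1) (l - 1) (l - 1 + (d - 1)) V2s"
    unfolding V2s_def by (auto dest: supported_shift simp: algebra_simps)
  have nonzero2: "\<not> (vanishing (j + 1 + 1) V2 \<and> vanishing (j + 1 + 1) V2s)"
    using vanishing_if_interpolate_row[OF step(2) cen1(1) lax1] nonzero1
    unfolding V2s_def vanishing_shift U2_def V2_def by blast
  have j2: "j + 1 + 1 = j + 2" by simp
  show ?thesis
    by (rule that) (use lax2 ag2 hinge2 supp2 nonzero2 in \<open>simp_all only: j2\<close>)
qed

section \<open>Counting unknowns: the cyclic linear system for the initial row\<close>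

definition linear_functional :: "(('a \<Rightarrow> complex) \<Rightarrow> complex) \<Rightarrow> bool" where
  "linear_functional L \<longleftrightarrow> (\<forall>a b u v. L (\<lambda>i. a * u i + b * v i) = a * L u + b * L v)"

text \<open>Each condition costs one unknown. Induction gives \<open>u1\<close> nonzero at
  \<open>i2\<close> and a nonzero \<open>u2\<close> vanishing at \<open>i2\<close>. Either
  \<open>u2\<close> meets the extra condition, or the combination that meets it is nonzero at
  \<open>i2\<close>.\<close>

lemma underdetermined_system:
  fixes L :: "'j \<Rightarrow> ('i \<Rightarrow> complex) \<Rightarrow> complex"
  assumes "finite J" "card J < card I" "\<And>j. j \<in> J \<Longrightarrow> linear_functional (L j)"
  shows "\<exists>u. (\<exists>i. u i \<noteq> 0) \<and> (\<forall>i. i \<notin> I \<longrightarrow> u i = 0) \<and> (\<forall>j\<in>J. L j u = 0)"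
  using assms
proof (induction J arbitrary: I rule: finite_induct)
  case empty
  then obtain i where "i \<in> I" by fastforce
  then show ?case by (intro exI[of _ "\<lambda>k. if k = i then 1 else 0"]) auto
next
  case (insert j J)
  have fin: "finite I" using insert.prems(1) by (metis card.infinite not_less_zero)
  have IH: "\<exists>u. (\<exists>i. u i \<noteq> 0) \<and> (\<forall>i. i \<notin> I - {k} \<longrightarrow> u i = 0) \<and> (\<forall>j\<in>J. L j u = 0)" for k
  proof (rule insert.IH)
    show "card J < card (I - {k})"
      using insert.prems(1) insert.hyps fin by (cases "k \<in> I") (auto simp: card_Diff_singleton)
  qed (use insert.prems in auto)
  obtain u1 i2 where u1: "u1 i2 \<noteq> 0" "\<forall>i. i \<notin> I \<longrightarrow> u1 i = 0" "\<forall>j\<in>J. L j u1 = 0"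
    using IH[of undefined] by blast
  obtain u2 where u2: "\<exists>i. u2 i \<noteq> 0" "\<forall>i. i \<notin> I - {i2} \<longrightarrow> u2 i = 0" "\<forall>j\<in>J. L j u2 = 0"
    using IH[of i2] by blast
  show ?case
  proof (cases "L j u2 = 0")
    case True
    then show ?thesis using u2 by (intro exI[of _ u2]) auto
  next
    case False
    define u where "u = (\<lambda>i. L j u2 * u1 i + - L j u1 * u2 i)"
    have L: "L k u = L j u2 * L k u1 + - L j u1 * L k u2" if "k \<in> insert j J" for k
      using insert.prems(2)[OF that] unfolding linear_functional_def u_def by blast
    have "u i2 \<noteq> 0" using u1(1) u2(2) False unfolding u_def by simp
    moreover have "u i = 0" if "i \<notin> I" for i using u1(2) u2(2) that unfolding u_def by simp
    moreover have "L k u = 0" if "k \<in> insert j J" for k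
      using L[OF that] u1(3) u2(3) that by auto
    ultimately show ?thesis by blast
  qed
qed

lemma cyclic_chain:
  fixes f :: "nat \<Rightarrow> 'a"
  assumes "\<And>k. k < m \<Longrightarrow> f (Suc k) = f k"
  shows "f m = f 0"
  using assms by (induction m) auto

text \<open>The difference of the two sides in \<open>hinged\<close> when the intersection point is
  the origin, as in the singular row \<open>0\<close>.\<close>

definition hinge_defect :: "complex \<Rightarrow> complex \<Rightarrow> complex \<Rightarrow> complex \<Rightarrow>
    (complex \<Rightarrow> complex) \<Rightarrow> (complex \<Rightarrow> complex) \<Rightarrow> complex" where
  "hinge_defect a x b y f g =
     cnj a * (y - b) * (f x - g x) - cnj b * (x - a) * (f y - g y)"

lemma hinge_defect_sum:
  "hinge_defect a x b y (\<lambda>z. \<Sum>n\<in>A. f n z) (\<lambda>z. \<Sum>n\<in>A. g n z) =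
     (\<Sum>n\<in>A. hinge_defect a x b y (f n) (g n))"
  unfolding hinge_defect_def
  by (simp add: sum_subtractf sum_distrib_left right_diff_distrib)

text \<open>In quotient form each side depends on one position only, so around a cycle the last
  condition follows from the others. This serves the top coefficient.\<close>

lemma hinge_defect_vanishing_at_points:
  assumes "\<And>z. f z = c * (z - x)" "\<And>z. g z = d * (z - y)" "x \<noteq> y" "a \<noteq> 0" "b \<noteq> 0"
  shows "hinge_defect a x b y f g = 0 \<longleftrightarrow> d * (y - b) / cnj b = c * (x - a) / cnj a"
proof -
  have "hinge_defect a x b y f g = (y - x) * (d * (y - b) * cnj a - c * (x - a) * cnj b)"
    unfolding hinge_defect_def assms(1,2) by (simp add: algebra_simps)
  then show ?thesis using assms(3-5) by (simp add: frac_eq_eq)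
qed

text \<open>Serves the sum over all coefficients: with a common value at the origin, the hinge
  condition becomes a plain equality of neighboring slopes, which again closes up around a
  cycle.\<close>

lemma hinge_defect_common_origin:
  assumes "\<And>z. f z = e + c * z" "\<And>z. g z = e + d * z" "x \<noteq> y" "a \<noteq> x" "b \<noteq> y"
    and "dist a 0 = dist a x" "dist b 0 = dist b y"
  shows "hinge_defect a x b y f g = 0 \<longleftrightarrow> d = c"
proof -
  have "(x - a) * cnj x = x * cnj a" "(y - b) * cnj y = y * cnj b"
    using assms(6,7)[THEN equidistant_cnj] by simp_all
  note e = this
  have "hinge_defect a x b y f g = (c - d) * ((y - b) * (x * cnj a) - (x - a) * (y * cnj b))"
    unfolding hinge_defect_def assms(1,2) by (simp add: algebra_simps)
  also have "\<dots> = (c - d) * (x - a) * (y - b) * cnj (x - y)"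
    unfolding e[symmetric] by (simp add: algebra_simps)
  finally have "hinge_defect a x b y f g = (c - d) * (x - a) * (y - b) * cnj (x - y)" .
  then show ?thesis using assms(3-5) by auto
qed

text \<open>There are \<open>m\<^sup>2 - 1\<close> unknown coefficients and \<open>m\<^sup>2\<close> linear conditions. Two conditions can be
  dropped: around the cycle, those for the top coefficients are dependent, and so are the sums over
  all coefficients (that is, the conditions at \<open>\<lambda> = 1\<close>).\<close>

lemma cyclic_lax_solution:
  fixes m :: nat and \<tau> v :: "nat \<Rightarrow> complex"
  assumes m: "m \<ge> 3"
    and "\<forall>k<m. \<tau> k \<noteq> 0 \<and> \<tau> k \<noteq> v k \<and> dist (\<tau> k) 0 = dist (\<tau> k) (v k)"
    and "\<forall>k<m. v k \<noteq> v (Suc k mod m)"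
  shows "\<exists>P Q. (\<forall>k n. affine_fun (P k n)) \<and> (\<forall>k n. affine_fun (Q k n)) \<and>
    (\<forall>k l n. P k n 0 = P l n 0) \<and>
    (\<forall>k. \<forall>n\<ge>m - 1. P k n = (\<lambda>_. 0)) \<and> (\<forall>k. \<forall>n\<ge>m - 1. Q k n = (\<lambda>_. 0)) \<and>
    (\<forall>k<m. P k 0 (v k) = 0) \<and>
    (\<forall>k<m. \<forall>n. P k n (\<tau> k) = Q k n (\<tau> k)) \<and>
    (\<forall>k<m. \<forall>n. P k (Suc n) (v k) = Q k n (v k)) \<and>
    (\<forall>k<m. \<forall>n. hinge_defect (\<tau> k) (v k) (\<tau> (Suc k mod m)) (v (Suc k mod m))
        (Q k n) (Q (Suc k mod m) n) = 0) \<and>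
    (\<exists>k<m. \<exists>n. P k n \<noteq> (\<lambda>_. 0))"
proof -
  note \<tau> = assms(2)[rule_format] and v = assms(3)[rule_format]
  \<comment> \<open>The unknown \<open>u (n, m)\<close> is the common value at \<open>0\<close> and
    \<open>u (n, k)\<close> the slope at position \<open>k\<close>, so agreement in row
    \<open>0\<close> is built in.\<close>
  define P where "P u k n z = (if n < m - 1 then u (n, m) + u (n, k) * z else 0)"
    for u :: "nat \<times> nat \<Rightarrow> complex" and k n :: nat and z :: complex
  define Q where "Q u k n = interpolate (\<tau> k) (P u k n (\<tau> k)) (v k) (P u k (Suc n) (v k))"
    for u k n
  define H where "H u k n = hinge_defect (\<tau> k) (v k) (\<tau> (Suc k mod m)) (v (Suc k mod m))
        (Q u k n) (Q u (Suc k mod m) n)" for u k n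
  \<comment> \<open>The index \<open>n = m - 1\<close>, one beyond the top exponent, encodes the
    condition on the lowest coefficient of \<open>P\<close>.\<close>
  define L where "L = (\<lambda>(n, k) u. if n = m - 1 then P u k 0 (v k) else H u k n)"
  have Plin: "P (\<lambda>i. a * u i + b * w i) k n z = a * P u k n z + b * P w k n z" for a b u w k n z
    unfolding P_def by (simp add: algebra_simps)
  have Qlin: "Q (\<lambda>i. a * u i + b * w i) k n z = a * Q u k n z + b * Q w k n z" for a b u w k n z
    unfolding Q_def interpolate_def Plin by (simp add: algebra_simps add_divide_distrib diff_divide_distrib)
  have Hlin: "H (\<lambda>i. a * u i + b * w i) k n = a * H u k n + b * H w k n" for a b u w k n
    unfolding H_def hinge_defect_def Qlin by (simp add: algebra_simps)
  have lin: "linear_functional (L j)" for j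
    unfolding linear_functional_def L_def by (cases j) (simp add: Plin Hlin)
  \<comment> \<open>The omitted conditions close the cycle for the lowest and the top coefficient;
    they are recovered as \<open>Hbot\<close> and \<open>Htop\<close>. They are two different ones
    because \<open>m \<ge> 3\<close>.\<close>
  define J where "J = {..<m} \<times> {..<m} - {(0, m - 1), (m - 2, m - 1)}"
  define I where "I = {..<m - 1} \<times> {..m}"
  have "card J = m * m - 2"
  proof -
    have "{(0, m - 1), (m - 2, m - 1)} \<subseteq> {..<m} \<times> {..<m}" using m by auto
    then have "card J = card ({..<m} \<times> {..<m}) - card {(0, m - 1), (m - 2, m - 1)}"
      unfolding J_def by (intro card_Diff_subset) auto
    then show ?thesis using m by simp
  qed
  moreover have "card I = m * m - 1"
  proof -
    obtain q where "m = Suc q" using m by (cases m) auto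
    then show ?thesis unfolding I_def by simp
  qed
  moreover have "m * m \<ge> 2" using mult_le_mono[OF m m] by simp
  ultimately have "card J < card I" by linarith
  moreover have "finite J" unfolding J_def by simp
  ultimately obtain u where u: "\<exists>i. u i \<noteq> 0" "\<And>i. i \<notin> I \<Longrightarrow> u i = 0" "\<And>j. j \<in> J \<Longrightarrow> L j u = 0"
    using underdetermined_system[of J I L] lin by blast
  have P0: "P u k 0 (v k) = 0" if "k < m" for k
    using u(3)[of "(m - 1, k)"] that m unfolding J_def L_def by auto
  have H0: "H u k n = 0" if "k < m" "n < m - 1" "k = m - 1 \<Longrightarrow> n \<noteq> 0 \<and> n \<noteq> m - 2" for k n
  proof -
    have "(n, k) \<in> J" using that unfolding J_def by auto
    from u(3)[OF this] that(2) show ?thesis unfolding L_def by simp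
  qed
  have P\<tau>: "P u k n (\<tau> k) = Q u k n (\<tau> k)" and Pv: "P u k (Suc n) (v k) = Q u k n (v k)"
    if "k < m" for k n
    using \<tau>[OF that] unfolding Q_def by (simp_all add: interpolate_left interpolate_right)
  have Pend: "P u k n = (\<lambda>_. 0)" if "n \<ge> m - 1" for k n
    using that unfolding P_def by auto
  have Qend: "Q u k n = (\<lambda>_. 0)" if "n \<ge> m - 1" for k n
    unfolding Q_def using Pend[OF that] Pend[of "Suc n"] that by simp
  have next_k: "Suc k mod m = Suc k" if "k < m - 1" for k using that by simp
  have next_last: "Suc (m - 1) mod m = 0" using m by simp
  define \<gamma> where "\<gamma> k = P u k (m - 2) (\<tau> k) / (\<tau> k - v k)" for k
  \<comment> \<open>Coefficient \<open>m - 1\<close> of \<open>P\<close> is zero, so the top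
    coefficient of \<open>Q\<close> vanishes at \<open>v k\<close>.\<close>
  have Qtop: "Q u k (m - 2) z = \<gamma> k * (z - v k)" for k z
  proof -
    have "Suc (m - 2) \<ge> m - 1" using m by simp
    then show ?thesis unfolding Q_def \<gamma>_def Pend[OF \<open>Suc (m - 2) \<ge> m - 1\<close>] interpolate_def by simp
  qed
  have top: "H u k (m - 2) = 0 \<longleftrightarrow> \<gamma> (Suc k mod m) * (v (Suc k mod m) - \<tau> (Suc k mod m)) / cnj (\<tau> (Suc k mod m))
      = \<gamma> k * (v k - \<tau> k) / cnj (\<tau> k)" if "k < m" for k
    unfolding H_def
    by (rule hinge_defect_vanishing_at_points[OF Qtop Qtop v[OF that]]) (use \<tau> that m in auto)
  have "\<gamma> (m - 1) * (v (m - 1) - \<tau> (m - 1)) / cnj (\<tau> (m - 1)) = \<gamma> 0 * (v 0 - \<tau> 0) / cnj (\<tau> 0)"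
  proof (rule cyclic_chain[where f = "\<lambda>k. \<gamma> k * (v k - \<tau> k) / cnj (\<tau> k)"])
    fix k assume k: "k < m - 1"
    then show "\<gamma> (Suc k) * (v (Suc k) - \<tau> (Suc k)) / cnj (\<tau> (Suc k)) = \<gamma> k * (v k - \<tau> k) / cnj (\<tau> k)"
      using top[of k] H0[of k "m - 2"] next_k[OF k] m by simp
  qed
  then have Htop: "H u (m - 1) (m - 2) = 0"
    using top[of "m - 1"] m unfolding next_last by simp
  define \<sigma> where "\<sigma> k = (\<Sum>n<m - 1. u (n, k))" for k
  \<comment> \<open>At \<lambda> = 1 both families agree at \<open>\<tau> k\<close> and at
    \<open>v k\<close>, hence everywhere; \<open>P0\<close> accounts for the term missing from the
    shifted sum.\<close>
  have Qsum: "(\<Sum>n<m - 1. Q u k n z) = \<sigma> m + \<sigma> k * z" if k: "k < m" for k z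
  proof -
    have S: "(\<Sum>n<m - 1. P u k n z) = \<sigma> m + \<sigma> k * z" for z
      unfolding P_def \<sigma>_def by (simp add: sum.distrib sum_distrib_right)
    have "(\<Sum>n<Suc (m - 1). P u k n (v k)) = P u k 0 (v k) + (\<Sum>n<m - 1. P u k (Suc n) (v k))"
      by (rule sum.lessThan_Suc_shift)
    then have S1: "(\<Sum>n<m - 1. P u k (Suc n) (v k)) = \<sigma> m + \<sigma> k * v k"
      using P0[OF k] Pend[of "m - 1" k] S[of "v k"] by simp
    have "(\<Sum>n<m - 1. Q u k n z) = interpolate (\<tau> k) (\<Sum>n<m - 1. P u k n (\<tau> k)) (v k) (\<Sum>n<m - 1. P u k (Suc n) (v k)) z"
      unfolding Q_def interpolate_def by (simp add: sum.distrib sum_distrib_right sum_divide_distrib)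
    also have "\<dots> = interpolate (\<tau> k) (\<sigma> m + \<sigma> k * \<tau> k) (v k) (\<sigma> m + \<sigma> k * v k) z"
      unfolding S S1 ..
    also have "\<dots> = \<sigma> m + \<sigma> k * z"
    proof -
      have "affine_fun (\<lambda>z. \<sigma> m + \<sigma> k * z)" unfolding affine_fun_def by blast
      from affine_fun_eqI[OF affine_fun_interpolate this, of "\<tau> k" "v k"] \<tau>[OF k]
      show ?thesis by (simp add: interpolate_left interpolate_right fun_eq_iff)
    qed
    finally show ?thesis .
  qed
  have total: "(\<Sum>n<m - 1. H u k n) = 0 \<longleftrightarrow> \<sigma> (Suc k mod m) = \<sigma> k" if "k < m" for k
    unfolding H_def hinge_defect_sum[symmetric]
    by (rule hinge_defect_common_origin[OF Qsum Qsum v]) (use \<tau> that m in auto)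
  have "\<sigma> (m - 1) = \<sigma> 0"
  proof (rule cyclic_chain)
    fix k assume k: "k < m - 1"
    then show "\<sigma> (Suc k) = \<sigma> k"
      using total[of k] H0[of k] next_k[OF k] by simp
  qed
  then have "(\<Sum>n<m - 1. H u (m - 1) n) = 0"
    using total[of "m - 1"] m unfolding next_last by simp
  \<comment> \<open>On the last link every defect but the lowest is already zero, so the sum
    isolates that one.\<close>
  moreover have "(\<Sum>n<m - 1. H u (m - 1) n) = H u (m - 1) 0"
  proof -
    have "H u (m - 1) n = 0" if "n \<in> {..<m - 1} - {0}" for n
      using H0[of "m - 1" n] Htop that m by (cases "n = m - 2") auto
    then have "(\<Sum>n\<in>{..<m - 1} - {0}. H u (m - 1) n) = 0" by (rule sum.neutral[rule_format])
    moreover have "0 \<in> {..<m - 1}" using m by simp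
    ultimately show ?thesis using sum.remove[of "{..<m - 1}" 0 "H u (m - 1)"] by simp
  qed
  ultimately have Hbot: "H u (m - 1) 0 = 0" by simp
  have Hall: "H u k n = 0" if "k < m" for k n
  proof (cases "n < m - 1")
    case True
    then show ?thesis using H0[OF that True] Htop Hbot by metis
  next
    case False
    then show ?thesis unfolding H_def hinge_defect_def by (simp add: Qend)
  qed
  have Paff: "affine_fun (P u k n)" for k n
    unfolding affine_fun_def
    by (rule exI[of _ "if n < m - 1 then u (n, m) else 0"], rule exI[of _ "if n < m - 1 then u (n, k) else 0"])
      (simp add: P_def)
  have "\<exists>k<m. \<exists>n. P u k n \<noteq> (\<lambda>_. 0)"
  proof -
    obtain n k where nk: "u (n, k) \<noteq> 0" using u(1) by auto
    then have I: "n < m - 1" "k \<le> m" using u(2)[of "(n, k)"] unfolding I_def by auto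
    show ?thesis
    proof (cases "k = m")
      case True
      then have "P u 0 n 0 \<noteq> 0" using nk I unfolding P_def by simp
      then have "P u 0 n \<noteq> (\<lambda>_. 0)" by metis
      then show ?thesis using m by (intro exI[of _ 0]) auto
    next
      case False
      have "P u k n 1 - P u k n 0 \<noteq> 0" using nk I unfolding P_def by simp
      then have "P u k n \<noteq> (\<lambda>_. 0)" by auto
      then show ?thesis using False I by (intro exI[of _ k]) auto
    qed
  qed
  moreover have "affine_fun (Q u k n)" for k n unfolding Q_def by simp
  moreover have "P u k n 0 = P u l n 0" for k l n unfolding P_def by simp
  moreover note Paff P0 P\<tau> Pv Pend Qend Hall[unfolded H_def]
  ultimately show ?thesis
    by (intro exI[of _ "P u"] exI[of _ "Q u"] conjI allI impI) simp_all
qed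

section \<open>Transfer of the cyclic solution to the singular initial data\<close>

lemma periodic_int:
  fixes f :: "int \<Rightarrow> 'a"
  assumes "\<And>i. f (i + p) = f i"
  shows "f (i + p * q) = f i"
proof (induction q rule: int_induct[of _ 0])
  case base
  show ?case by simp
next
  case (step1 q)
  then show ?case using assms[of "i + p * q"] by (simp add: algebra_simps)
next
  case (step2 q)
  then show ?case using assms[of "i + p * (q - 1)"] by (simp add: algebra_simps)
qed

lemma odd_int_constant:
  fixes f :: "int \<Rightarrow> 'a"
  assumes "\<And>i. even i \<Longrightarrow> f (i - 1) = f (i + 1)" "odd i"
  shows "f i = f 1"
proof -
  have "f (2 * q + 1 + 2) = f (2 * q + 1)" for q
    using assms(1)[of "2 * q + 2"] by (simp add: add.commute)
  then have "f (2 * (q + 1) + 1) = f (2 * q + 1)" for q by (simp add: algebra_simps)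
  then have "(\<lambda>q. f (2 * q + 1)) (0 + 1 * (i div 2)) = f (2 * 0 + 1)"
    by (intro periodic_int[where f = "\<lambda>q. f (2 * q + 1)"])
  moreover have "2 * (i div 2) + 1 = i" using assms(2) by simp
  ultimately show ?thesis by simp
qed

lemma singular_initial_lax_solution:
  fixes z w :: "int \<Rightarrow> nat \<Rightarrow> complex"
  assumes m: "m \<ge> 3" and data: "circle_initial_data v t" and closed: "closed_data (2 * m) v t"
    and sing: "\<And>i. even i \<Longrightarrow> v i = 0" and init: "initial_rows v t z w"
    and step: "propagation_row z w 0"
  obtains U V where "lax_solution z w 0 U V" "hinged z w 0 V" "centered_row z w 0"
    "supported 0 0 (int m - 2) U" "supported 0 0 (int m - 2) V" "\<not> vanishing 0 U"
proof -
  have row0: "z i 0 = 0" if "even i" for i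
    using init sing that unfolding initial_rows_def by simp
  have row1: "w i 1 = v i" "z i 1 = t i" if "odd i" for i
    using init that unfolding initial_rows_def by auto
  have circle: "t i \<noteq> 0 \<and> t i \<noteq> v i \<and> dist (t i) 0 = dist (t i) (v i)" if "odd i" for i
  proof -
    obtain C where "circle_with_center (t i) C" "{v (i - 1), v i, v (i + 1)} \<subseteq> C"
      using data unfolding circle_initial_data_def by blast
    moreover have "v (i - 1) = 0" using sing that by simp
    ultimately show ?thesis unfolding circle_with_center_def by auto
  qed
  \<comment> \<open>Numbers the odd positions modulo \<open>2 * m\<close>: position
    \<open>2 * k + 1\<close> receives \<open>k\<close> modulo \<open>m\<close>.\<close>
  define \<kappa> where "\<kappa> i = nat ((i div 2) mod int m)" for i :: int
  have \<kappa>less: "\<kappa> i < m" for i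
    using m unfolding \<kappa>_def by (simp add: nat_less_iff)
  have \<kappa>int: "int (\<kappa> i) = (i div 2) mod int m" for i
    using m unfolding \<kappa>_def by simp
  have \<kappa>next: "\<kappa> (i + 1) = Suc (\<kappa> (i - 1)) mod m" if "even i" for i
  proof -
    have "(i + 1) div 2 = (i - 1) div 2 + 1" using that by presburger
    then have "int (\<kappa> (i + 1)) = int (Suc (\<kappa> (i - 1)) mod m)"
      unfolding zmod_int of_nat_Suc \<kappa>int by (simp add: mod_simps add.commute)
    then show ?thesis by simp
  qed
  have \<kappa>odd: "\<kappa> (2 * int k + 1) = k" if "k < m" for k
    using that unfolding \<kappa>_def by simp
  define vv where "vv k = v (2 * int k + 1)" for k
  define \<tau> where "\<tau> k = t (2 * int k + 1)" for k
  have vt: "v i = vv (\<kappa> i)" "t i = \<tau> (\<kappa> i)" if "odd i" for i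
  proof -
    have "i = 2 * (i div 2) + 1" using that by simp
    moreover have "i div 2 = int (\<kappa> i) + int m * (i div 2 div int m)" unfolding \<kappa>int by simp
    ultimately have "i = 2 * (int (\<kappa> i) + int m * (i div 2 div int m)) + 1" by simp
    then have i: "i = 2 * int (\<kappa> i) + 1 + int (2 * m) * (i div 2 div int m)"
      by (simp only: ring_distribs of_nat_mult of_nat_numeral ac_simps)
    show "v i = vv (\<kappa> i)" "t i = \<tau> (\<kappa> i)"
      using closed periodic_int[of v "int (2 * m)" "2 * int (\<kappa> i) + 1" "i div 2 div int m"]
        periodic_int[of t "int (2 * m)" "2 * int (\<kappa> i) + 1" "i div 2 div int m"]
      unfolding closed_data_def vv_def \<tau>_def i[symmetric] by auto
  qed
  have \<tau>circle: "\<forall>k<m. \<tau> k \<noteq> 0 \<and> \<tau> k \<noteq> vv k \<and> dist (\<tau> k) 0 = dist (\<tau> k) (vv k)"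
    using circle unfolding vv_def \<tau>_def by simp
  have vne: "\<forall>k<m. vv k \<noteq> vv (Suc k mod m)"
  proof (intro allI impI)
    fix k assume k: "k < m"
    \<comment> \<open>Neighboring points differ because the first propagation step draws a unique
      circle through them and a third point.\<close>
    have "w (2 * int k + 2 - 1) (0 + 1) \<noteq> w (2 * int k + 2 + 1) (0 + 1)"
      by (rule center_of_circle_throughD(4)[OF propagation_rowD(2)[OF step]]) simp
    then have "v (2 * int k + 1) \<noteq> v (2 * int k + 2 + 1)" using row1 by (simp add: add.commute)
    moreover have "\<kappa> (2 * int k + 2 + 1) = Suc k mod m"
      using \<kappa>next[of "2 * int k + 2"] \<kappa>odd[OF k] by (simp add: add.commute)
    ultimately show "vv k \<noteq> vv (Suc k mod m)"
      using vt(1)[of "2 * int k + 2 + 1"] unfolding vv_def by simp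
  qed
  obtain P Q where "\<forall>k n. affine_fun (P k n)" "\<forall>k n. affine_fun (Q k n)"
    "\<forall>k l n. P k n 0 = P l n 0"
    "\<forall>k. \<forall>n\<ge>m - 1. P k n = (\<lambda>_. 0)" "\<forall>k. \<forall>n\<ge>m - 1. Q k n = (\<lambda>_. 0)"
    "\<forall>k<m. P k 0 (vv k) = 0"
    "\<forall>k<m. \<forall>n. P k n (\<tau> k) = Q k n (\<tau> k)"
    "\<forall>k<m. \<forall>n. P k (Suc n) (vv k) = Q k n (vv k)"
    "\<forall>k<m. \<forall>n. hinge_defect (\<tau> k) (vv k) (\<tau> (Suc k mod m)) (vv (Suc k mod m))
        (Q k n) (Q (Suc k mod m) n) = 0"
    "\<exists>k<m. \<exists>n. P k n \<noteq> (\<lambda>_. 0)"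
    using cyclic_lax_solution[OF m \<tau>circle vne]
    by - (erule exE, erule exE, elim conjE, rule that)
  note PQ = this[rule_format]
  define U where "U i n = (if n < 0 then \<lambda>_. 0 else P (\<kappa> i) (nat n))" for i n :: int
  define V where "V i n = (if n < 0 then \<lambda>_. 0 else Q (\<kappa> i) (nat n))" for i n :: int
  have T: "U i n (z i 1) = V i n (z i 1) \<and> U i (n + 1) (w i 1) = V i n (w i 1)" if i: "odd i" for i n
  proof -
    have e: "z i 1 = \<tau> (\<kappa> i)" "w i 1 = vv (\<kappa> i)" using row1[OF i] vt[OF i] by auto
    \<comment> \<open>At \<open>n = - 1\<close> the function \<open>V i n\<close> is zero, so the
      relation with \<open>U i 0\<close> is the extra condition on the lowest coefficient of
      \<open>P\<close>.\<close>
    consider "n \<ge> 0" | "n = - 1" | "n < - 1" by linarith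
    then show ?thesis
    proof cases
      case 1
      then have "nat (n + 1) = Suc (nat n)" by simp
      with 1 show ?thesis unfolding U_def V_def e using PQ(7,8) \<kappa>less by simp
    next
      case 2
      then show ?thesis unfolding U_def V_def e using PQ(6) \<kappa>less by simp
    next
      case 3
      then show ?thesis unfolding U_def V_def by simp
    qed
  qed
  show ?thesis
  proof (rule that)
    show "lax_solution z w 0 U V"
      unfolding lax_solution_def agree_def
    proof (intro conjI allI impI)
      fix i n :: int
      show "affine_fun (U i n)" "affine_fun (V i n)" unfolding U_def V_def using PQ(1,2) by auto
      show "U i n (z i (0 + 1)) = V i n (z i (0 + 1))" "U i (n + 1) (w i (0 + 1)) = V i n (w i (0 + 1))"
        if "even i \<noteq> even (0 :: nat)" using T[of i n] that by simp_all
      show "U (i - 1) n (z i 0) = U (i + 1) n (z i 0)" if "even i = even (0 :: nat)"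
        using row0[of i] that PQ(3) unfolding U_def by simp
    qed
    show "hinged z w 0 V"
      unfolding hinged_def
    proof (intro allI impI)
      fix i n :: int assume "even i = even (0 :: nat)"
      then have i: "even i" "odd (i - 1)" "odd (i + 1)" by auto
      have e: "z (i - 1) 1 = \<tau> (\<kappa> (i - 1))" "w (i - 1) 1 = vv (\<kappa> (i - 1))"
        "z (i + 1) 1 = \<tau> (\<kappa> (i + 1))" "w (i + 1) 1 = vv (\<kappa> (i + 1))" "z i 0 = 0"
        using row1 vt row0 i by metis+
      have "hinge_defect (z (i - 1) 1) (w (i - 1) 1) (z (i + 1) 1) (w (i + 1) 1) (V (i - 1) n) (V (i + 1) n) = 0"
      proof (cases "n < 0")
        case True
        then show ?thesis unfolding hinge_defect_def V_def by simp
      next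
        case False
        then show ?thesis
          using PQ(9)[OF \<kappa>less[of "i - 1"], of "nat n"] unfolding e \<kappa>next[OF i(1)] V_def by simp
      qed
      then show "cnj (z (i - 1) (0 + 1) - z i 0) * (w (i + 1) (0 + 1) - z (i + 1) (0 + 1)) *
          (V (i - 1) n (w (i - 1) (0 + 1)) - V (i + 1) n (w (i - 1) (0 + 1))) =
        cnj (z (i + 1) (0 + 1) - z i 0) * (w (i - 1) (0 + 1) - z (i - 1) (0 + 1)) *
          (V (i - 1) n (w (i + 1) (0 + 1)) - V (i + 1) n (w (i + 1) (0 + 1)))"
        unfolding hinge_defect_def e(5) by simp
    qed
    show "centered_row z w 0"
      unfolding centered_row_def using row0 row1 circle by simp
    have "U i n = (\<lambda>_. 0) \<and> V i n = (\<lambda>_. 0)" if "n \<notin> {0..int m - 2}" for i n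
      using that PQ(4,5)[of "nat n"] m unfolding U_def V_def by auto
    then show "supported 0 0 (int m - 2) U" "supported 0 0 (int m - 2) V"
      unfolding supported_def by blast+
    obtain k n where k: "k < m" "P k n \<noteq> (\<lambda>_. 0)" using PQ(10) by blast
    then have "U (2 * int k + 1) (int n) \<noteq> (\<lambda>_. 0)"
      unfolding U_def by (simp add: \<kappa>odd)
    then show "\<not> vanishing 0 U" unfolding vanishing_def by fastforce
  qed
qed

section \<open>Collapse of the solution to a single affine function\<close>

theorem theorem8p5:
  fixes m :: nat
    and v t :: "int \<Rightarrow> complex"
    and z w :: "int \<Rightarrow> nat \<Rightarrow> complex"
  assumes "m \<ge> 3"
    and "circle_initial_data v t"
    and "closed_data (2 * m) v t"
    and "\<forall>i. even i \<longrightarrow> v i = 0"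
    and "initial_rows v t z w"
    and "\<forall>j < 2 * m - 4. propagation z w j"
  shows "\<exists>s :: riemann_sphere. \<forall>i. odd i \<longrightarrow> Some (w i (2 * m - 3)) = s"
proof -
  have steps: "propagation_row z w (2 * k)" "propagation_row w z (2 * k + 1)" if "k < m - 2" for k
  proof -
    have "2 * k < 2 * m - 4" "2 * k + 1 < 2 * m - 4" using that by auto
    then have "propagation z w (2 * k)" "propagation z w (2 * k + 1)" using assms(6) by blast+
    then show "propagation_row z w (2 * k)" "propagation_row w z (2 * k + 1)"
      unfolding propagation_def by simp_all
  qed
  have "propagation_row z w 0" using steps(1)[of 0] assms(1) by simp
  then obtain U0 V0 where start: "lax_solution z w 0 U0 V0" "hinged z w 0 V0" "centered_row z w 0"
    "supported 0 0 (int m - 2) U0" "supported 0 0 (int m - 2) V0" "\<not> vanishing 0 U0"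
    using singular_initial_lax_solution[OF assms(1,2,3) _ assms(5)] assms(4) by metis
  \<comment> \<open>After \<open>2 * k\<close> steps at most \<open>m - 1 - k\<close> exponents are
    left, the lowest being \<open>- k\<close>. In row \<open>0\<close> only the hinge condition is
    available, so \<open>agree\<close> is claimed for \<open>k > 0\<close>.\<close>
  have "\<exists>U V. lax_solution z w (2 * k) U V \<and> hinged z w (2 * k) V \<and> centered_row z w (2 * k) \<and>
      supported (2 * k) (- int k) (- int k + (int m - 2 - int k)) U \<and>
      supported (2 * k) (- int k) (- int k + (int m - 2 - int k)) V \<and>
      \<not> (vanishing (2 * k) U \<and> vanishing (2 * k) V) \<and> (k > 0 \<longrightarrow> agree w (2 * k) V)"
    if "k \<le> m - 2" for k
    using that
  proof (induction k)
    case 0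
    show ?case by (rule exI[of _ U0], rule exI[of _ V0]) (use start in simp)
  next
    case (Suc k)
    then have k: "k < m - 2" by simp
    from Suc obtain U V where UV: "lax_solution z w (2 * k) U V" "hinged z w (2 * k) V"
      "centered_row z w (2 * k)"
      "supported (2 * k) (- int k) (- int k + (int m - 2 - int k)) U"
      "supported (2 * k) (- int k) (- int k + (int m - 2 - int k)) V"
      "\<not> (vanishing (2 * k) U \<and> vanishing (2 * k) V)" by auto
    obtain U' V' where new: "lax_solution z w (2 * k + 2) U' V'" "agree w (2 * k + 2) V'"
      "hinged z w (2 * k + 2) V'"
      "supported (2 * k + 2) (- int k - 1) (- int k - 1 + (int m - 2 - int k - 1)) U'"
      "supported (2 * k + 2) (- int k - 1) (- int k - 1 + (int m - 2 - int k - 1)) V'"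
      "\<not> (vanishing (2 * k + 2) U' \<and> vanishing (2 * k + 2) V')"
      by (rule lax_solution_propagate_twice[OF steps(1)[OF k] steps(2)[OF k] UV(3,1,2,4,5,6)])
    have e: "2 * Suc k = 2 * k + 2" "2 * k + 1 + 1 = 2 * k + 2" "- int (Suc k) = - int k - 1"
      "int m - 2 - int (Suc k) = int m - 2 - int k - 1" by simp_all
    have "centered_row z w (2 * k + 1 + 1)"
      using propagation_row_invariants(1)[OF steps(2)[OF k]
          propagation_row_invariants(1)[OF steps(1)[OF k] UV(3)]] .
    with new show ?case unfolding e by blast
  qed
  from this[of "m - 2"] obtain U V where UV: "lax_solution z w (2 * (m - 2)) U V"
    "centered_row z w (2 * (m - 2))" "agree w (2 * (m - 2)) V"
    and supp: "supported (2 * (m - 2)) (- int (m - 2)) (- int (m - 2)) U"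
      "supported (2 * (m - 2)) (- int (m - 2)) (- int (m - 2)) V"
    and nonzero: "\<not> (vanishing (2 * (m - 2)) U \<and> vanishing (2 * (m - 2)) V)"
    using assms(1) by (auto simp: of_nat_diff)
  define j where "j = 2 * (m - 2)"
  define n where "n = - int (m - 2)"
  note UV = UV[folded j_def] and supp = supp[folded j_def n_def] and nonzero = nonzero[folded j_def]
  have ev: "even j" unfolding j_def by simp
  have J: "2 * m - 3 = j + 1" using assms(1) unfolding j_def by simp
  have aff: "affine_fun (U i n)" "affine_fun (V i n)" for i
    using UV(1) unfolding lax_solution_def by auto
  \<comment> \<open>Only the exponent \<open>n\<close> remains, so the relations at \<open>w\<close>
    compare with the zero coefficients \<open>n - 1\<close> and \<open>n + 1\<close>: both
    \<open>U i n\<close> and \<open>V i n\<close> vanish there.\<close>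
  have UV0: "U i n (w i (j + 1)) = 0" and UV_eq: "U i n = V i n" if i: "odd i" for i
  proof -
    have i': "even i \<noteq> even j" using i ev by simp
    show *: "U i n (w i (j + 1)) = 0"
      using lax_solution_swap(2)[OF UV(1) i', of "n - 1"] supported_zero[OF supp(2) i', of "n - 1"] by simp
    have "V i n (w i (j + 1)) = 0"
      using lax_solution_swap(2)[OF UV(1) i', of n] supported_zero[OF supp(1) i', of "n + 1"] by simp
    moreover have "z i (j + 1) \<noteq> w i (j + 1)"
      using UV(2) i' unfolding centered_row_def by blast
    ultimately show "U i n = V i n"
      using affine_fun_eqI[OF aff, of "z i (j + 1)" "w i (j + 1)" i i]
        lax_solution_swap(1)[OF UV(1) i', of n] * by simp
  qed
  \<comment> \<open>The neighbors agree at \<open>z i j\<close> through \<open>U\<close> and at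
    \<open>w i j\<close> through \<open>V\<close>, which now equals \<open>U\<close>.\<close>
  have "U (i - 1) n = U (i + 1) n" if i: "even i" for i
  proof (rule affine_fun_eqI[OF aff(1) aff(1)])
    \<comment> \<open>Since \<open>m \<ge> 3\<close>, row \<open>j\<close> was produced by a
      propagation step, which separates a center from its point.\<close>
    have "2 * (m - 3) + 2 = j" using assms(1) unfolding j_def by simp
    moreover have "w i (2 * (m - 3) + 2) \<noteq> z i (2 * (m - 3) + 2)"
      by (rule center_of_circle_throughD(3)[OF propagation_rowD(2)[OF steps(1)]])
        (use assms(1) i in auto)
    ultimately show "w i j \<noteq> z i j" by simp
    show "U (i - 1) n (z i j) = U (i + 1) n (z i j)"
      using UV(1) i ev unfolding lax_solution_def agree_def by simp
    show "U (i - 1) n (w i j) = U (i + 1) n (w i j)"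
      using UV(3) i ev UV_eq unfolding agree_def by simp
  qed
  then have const: "U i n = U 1 n" if "odd i" for i
    by (rule odd_int_constant[where f = "\<lambda>i. U i n"]) (use that in auto)
  have "U 1 n \<noteq> (\<lambda>_. 0)"
  proof
    assume 0: "U 1 n = (\<lambda>_. 0)"
    have "U i n' = (\<lambda>_. 0) \<and> V i n' = (\<lambda>_. 0)" if i: "even i \<noteq> even j" for i n'
    proof (cases "n' = n")
      case True
      then show ?thesis using const[of i] UV_eq[of i] 0 i ev by simp
    next
      case False
      then show ?thesis using supported_zero[OF supp(1) i] supported_zero[OF supp(2) i] by simp
    qed
    then show False using nonzero unfolding vanishing_def by blast
  qed
  \<comment> \<open>A nonzero affine function has at most one zero.\<close>
  then have "w i (j + 1) = w 1 (j + 1)" if "odd i" for i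
    using affine_fun_eqI[OF aff(1) affine_fun_zero, of "w i (j + 1)" "w 1 (j + 1)" 1]
      UV0[OF that] UV0[of 1] const[OF that] by auto
  then show ?thesis unfolding J by blast
qed

end
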